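(* Let $k \ge 2$ and $m \ge 1$ be integers and $n = km$. Let $Z=\langle z_1, z_2, \ldots, z_{km}\rangle$ be a position of $\frac{k-1}{k}n$-delete Nim, where $z_1 \le z_2 \le \cdots \le z_{km}$ are positive integers. Let $k^s$ be the smallest power of $k$ strictly greater than $z_{(k-1)m+1}$. Then $Z$ is a $\mathcal{P}$-position if and only if both of the following hold: (a) all of $z_1, z_2, \ldots, z_{(k-1)m+1}$ are $k$-oddoid; (b) for every $l \in \{1,\ldots,km\}$, if $z_l$ is $k$-evenoid then $k^s \le z_l$.
   Context: For an integer $k\ge 2$, a positive integer is called $k$-oddoid if its remainder upon division by $k(k-1)$ lies between $1$ and $k-1$ (inclusive); every other positive integer is called $k$-evenoid. $\frac{k-1}{k}n$-delete Nim with $n = km$ heaps: a position is a $km$-tuple of positive integers (heap sizes). Two players alternate moves. A move consists of selecting $(k-1)m$ heaps and deleting them, and then splitting each of the remaining $m$ heaps into $k$ heaps, each containing at least one token (so the number of heaps stays $km$). Normal play convention: a player who cannot move loses. A $\mathcal{P}$-position is a position from which the player about to move has no winning strategy. *)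

theory Defs
  imports Complex_Main "HOL-Library.Multiset"
begin

definition oddoid :: "nat \<Rightarrow> nat \<Rightarrow> bool" where
  "oddoid k z \<longleftrightarrow> 0 < z \<and> z mod (k * (k - 1)) \<in> {1..k - 1}"

definition evenoid :: "nat \<Rightarrow> nat \<Rightarrow> bool" where
  "evenoid k z \<longleftrightarrow> 0 < z \<and> \<not> oddoid k z"

definition nim_position :: "nat \<Rightarrow> nat \<Rightarrow> nat list \<Rightarrow> bool" where
  "nim_position k m Z \<longleftrightarrow> length Z = k * m \<and> (\<forall>z \<in> set Z. 0 < z)"

text \<open>
  \<open>D\<close> is the set of (0-based) indices of the deleted heaps, and \<open>parts i\<close> is the multiset of
  heaps into which the remaining heap \<open>i\<close> is split. The order in which the resulting heaps
  are listed is immaterial, so every arrangement \<open>Z'\<close> of them is a legal result.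
\<close>

definition nim_move :: "nat \<Rightarrow> nat \<Rightarrow> nat list \<Rightarrow> nat list \<Rightarrow> bool" where
  "nim_move k m Z Z' \<longleftrightarrow>
     (\<exists>D parts. D \<subseteq> {..<k * m} \<and> card D = (k - 1) * m \<and>
        (\<forall>i \<in> {..<k * m} - D.
           size (parts i) = k \<and> (\<forall>x \<in># parts i. 0 < x) \<and> sum_mset (parts i) = Z ! i) \<and>
        mset Z' = (\<Sum>i \<in> {..<k * m} - D. parts i))"

text \<open>
  A strategy maps each position to the position moved to. \<open>on_turn k m \<sigma> Z\<close> holds of the
  positions in which a player who starts at \<open>Z\<close> and follows \<open>\<sigma>\<close> can be on turn.
\<close>

inductive on_turn ::
  "nat \<Rightarrow> nat \<Rightarrow> (nat list \<Rightarrow> nat list) \<Rightarrow> nat list \<Rightarrow> nat list \<Rightarrow> bool"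
  for k m \<sigma> Z where
  start: "on_turn k m \<sigma> Z Z"
| reply: "on_turn k m \<sigma> Z W \<Longrightarrow> nim_move k m (\<sigma> W) V \<Longrightarrow> on_turn k m \<sigma> Z V"

text \<open>
  Normal play: the player who cannot move loses. Each move decreases the total number of
  tokens (\<open>nim_move_less\<close> below), so every play ends, and a strategy wins iff it
  supplies a legal move whenever its owner is on turn.
\<close>

definition winning_strategy :: "nat \<Rightarrow> nat \<Rightarrow> (nat list \<Rightarrow> nat list) \<Rightarrow> nat list \<Rightarrow> bool" where
  "winning_strategy k m \<sigma> Z \<longleftrightarrow> (\<forall>W. on_turn k m \<sigma> Z W \<longrightarrow> nim_move k m W (\<sigma> W))"

definition P_position :: "nat \<Rightarrow> nat \<Rightarrow> nat list \<Rightarrow> bool" where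
  "P_position k m Z \<longleftrightarrow> nim_position k m Z \<and> \<not> (\<exists>\<sigma>. winning_strategy k m \<sigma> Z)"

lemma nim_move_position:
  assumes "1 \<le> k" "nim_move k m Z Z'"
  shows "nim_position k m Z'"
proof -
  obtain D parts where D: "D \<subseteq> {..<k * m}" "card D = (k - 1) * m"
    and p: "\<forall>i \<in> {..<k * m} - D. size (parts i) = k \<and> (\<forall>x \<in># parts i. 0 < x)"
    and Z': "mset Z' = (\<Sum>i \<in> {..<k * m} - D. parts i)"
    using assms(2) unfolding nim_move_def by metis
  have "finite D" using D(1) finite_subset by blast
  then have "card ({..<k * m} - D) = k * m - (k - 1) * m"
    using D by (simp add: card_Diff_subset)
  also have "\<dots> = m" using assms(1) by (simp add: algebra_simps diff_mult_distrib)
  finally have c: "card ({..<k * m} - D) = m" .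
  have sz: "size (\<Sum>i \<in> A. parts i) = (\<Sum>i \<in> A. size (parts i))" if "finite A" for A
    using that by (induction A rule: finite_induct) auto
  have "length Z' = size (\<Sum>i \<in> {..<k * m} - D. parts i)" using Z' by (metis size_mset)
  also have "\<dots> = (\<Sum>i \<in> {..<k * m} - D. size (parts i))"
    by (rule sz) simp
  also have "\<dots> = (\<Sum>i \<in> {..<k * m} - D. k)" using p by (intro sum.cong) auto
  also have "\<dots> = k * m" using c by simp
  finally have len: "length Z' = k * m" .
  have "0 < z" if "z \<in> set Z'" for z
  proof -
    have "z \<in># (\<Sum>i \<in> {..<k * m} - D. parts i)" using that Z' by (metis set_mset_mset)
    then obtain i where "i \<in> {..<k * m} - D" "z \<in># parts i"
      by (auto simp: set_mset_sum)
    then show ?thesis using p by blast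
  qed
  then show ?thesis using len unfolding nim_position_def by blast
qed

lemma nim_move_less:
  assumes "2 \<le> k" "1 \<le> m" "nim_position k m Z" "nim_move k m Z Z'"
  shows "sum_list Z' < sum_list Z"
proof -
  obtain D parts where D: "D \<subseteq> {..<k * m}" "card D = (k - 1) * m"
    and p: "\<forall>i \<in> {..<k * m} - D. sum_mset (parts i) = Z ! i"
    and Z': "mset Z' = (\<Sum>i \<in> {..<k * m} - D. parts i)"
    using assms(4) unfolding nim_move_def by metis
  have len: "length Z = k * m" using assms(3) by (simp add: nim_position_def)
  have sm: "sum_mset (\<Sum>i \<in> A. parts i) = (\<Sum>i \<in> A. sum_mset (parts i))"
    if "finite A" for A
    using that by (induction A rule: finite_induct) auto
  have "sum_list Z' = sum_mset (mset Z')" by (simp add: sum_mset_sum_list)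
  also have "\<dots> = (\<Sum>i \<in> {..<k * m} - D. sum_mset (parts i))"
    unfolding Z' by (rule sm) simp
  also have "\<dots> = (\<Sum>i \<in> {..<k * m} - D. Z ! i)"
    using p by (intro sum.cong) auto
  finally have e1: "sum_list Z' = (\<Sum>i \<in> {..<k * m} - D. Z ! i)" .
  have "sum_list Z = (\<Sum>i \<in> {..<k * m}. Z ! i)"
    using len by (simp add: sum_list_sum_nth atLeast0LessThan)
  also have "\<dots> = (\<Sum>i \<in> {..<k * m} - D. Z ! i) + (\<Sum>i \<in> D. Z ! i)"
    using D(1) by (intro sum.subset_diff) auto
  finally have e2: "sum_list Z = sum_list Z' + (\<Sum>i \<in> D. Z ! i)" using e1 by simp
  have fin: "finite D" using D(1) finite_subset by blast
  have "D \<noteq> {}" using D(2) assms(1,2) by auto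
  moreover have "0 < Z ! i" if "i \<in> D" for i
    using that D(1) assms(3) len unfolding nim_position_def by (auto simp: subset_eq)
  ultimately have "0 < (\<Sum>i \<in> D. Z ! i)" using fin by (intro sum_pos) auto
  then show ?thesis using e2 by simp
qed

lemma winning_strategy_unfold:
  "(\<exists>\<sigma>. winning_strategy k m \<sigma> Z) \<longleftrightarrow>
   (\<exists>Z'. nim_move k m Z Z' \<and> (\<forall>V. nim_move k m Z' V \<longrightarrow> (\<exists>\<sigma>. winning_strategy k m \<sigma> V)))"
  (is "?win Z \<longleftrightarrow> (\<exists>Z'. ?good Z Z')")
proof -
  have A: "\<exists>Z'. ?good Z Z'" if win: "?win Z" for Z
  proof -
    obtain \<sigma> where \<sigma>: "winning_strategy k m \<sigma> Z" using win by blast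
    have "winning_strategy k m \<sigma> V" if "nim_move k m (\<sigma> Z) V" for V
    proof -
      have "on_turn k m \<sigma> Z W" if "on_turn k m \<sigma> V W" for W
        using that
      proof (induction rule: on_turn.induct)
        case start
        show ?case using \<open>nim_move k m (\<sigma> Z) V\<close> on_turn.start on_turn.reply by metis
      next
        case (reply W U)
        then show ?case using on_turn.reply by metis
      qed
      then show ?thesis using \<sigma> unfolding winning_strategy_def by blast
    qed
    moreover have "nim_move k m Z (\<sigma> Z)"
      using \<sigma> on_turn.start unfolding winning_strategy_def by metis
    ultimately show ?thesis by blast
  qed
  have B: "?win Z" if ex: "\<exists>Z'. ?good Z Z'"
  proof -
    define \<sigma> where "\<sigma> = (\<lambda>W. SOME W'. ?good W W')"
    have s: "?good W (\<sigma> W)" if "\<exists>W'. ?good W W'" for W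
      unfolding \<sigma>_def using that by (rule someI_ex)
    have "\<exists>W'. ?good W W'" if "on_turn k m \<sigma> Z W" for W
      using that
    proof (induction rule: on_turn.induct)
      case start
      show ?case by (rule ex)
    next
      case (reply W U)
      then have "?win U" using s by blast
      then show ?case by (rule A)
    qed
    then have "winning_strategy k m \<sigma> Z" using s unfolding winning_strategy_def by blast
    then show ?thesis by blast
  qed
  show ?thesis using A B by blast
qed

lemma P_position_iff:
  assumes "2 \<le> k" "1 \<le> m" "nim_position k m Z"
  shows "P_position k m Z \<longleftrightarrow> (\<forall>Z'. nim_move k m Z Z' \<longrightarrow> \<not> P_position k m Z')"
  using assms(3)
proof (induction "sum_list Z" arbitrary: Z rule: less_induct)
  case less
  have pos: "nim_position k m Z'" if "nim_move k m Y Z'" for Y Z'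
    using nim_move_position that assms(1) by simp
  have "P_position k m Z' \<longleftrightarrow> (\<forall>V. nim_move k m Z' V \<longrightarrow> \<not> P_position k m V)"
    if "nim_move k m Z Z'" for Z'
    using less.hyps nim_move_less[OF assms(1,2) less.prems that] pos[OF that] by blast
  then show ?case
    using winning_strategy_unfold[of k m Z] less.prems pos
    unfolding P_position_def by blast
qed

end

theory Submission
  imports Defs
begin

text \<open>
  Sums of \<open>k\<close> oddoids are exactly the evenoids, and an evenoid below \<open>k ^ (e + 1)\<close> splits into
  \<open>k\<close> oddoids below \<open>k ^ e\<close>. Call a position balanced if for each evenoid heap below
  \<open>k ^ (e + 1)\<close> fewer than \<open>m\<close> heaps are at least \<open>k ^ e\<close>.

  From an unbalanced position, take an offending evenoid with the least \<open>e\<close>, keep it and \<open>m - 1\<close>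
  other heaps of size at least \<open>k ^ e\<close>, split the evenoid into oddoids below \<open>k ^ e\<close>, and split each
  other heap so that at most one part reaches \<open>k ^ e\<close> and all smaller parts are oddoid: the
  result is balanced.

  In a balanced position the smallest kept heap is oddoid, so a move creates an evenoid part. If
  \<open>e\<close> is least such that some evenoid part is below \<open>k ^ (e + 1)\<close>, a kept heap all of whose parts
  are below \<open>k ^ e\<close> would be an evenoid below \<open>k ^ (e + 1)\<close>, while all \<open>m\<close> kept heaps are at least
  \<open>k ^ e\<close>. So each kept heap leaves a part of size at least \<open>k ^ e\<close>, and the result is unbalanced.
\<close>

section \<open>Arithmetic of oddoids, evenoids and powers of \<open>k\<close>\<close>

text \<open>Replacing the residue 0 by \<open>k * (k - 1)\<close> turns the evenoid residues into
  one interval, which is the range of sums of \<open>k\<close> numbers from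
  \<open>{1..k - 1}\<close>.\<close>

lemma evenoid_iff_decomposition:
  assumes "2 \<le> k"
  shows "evenoid k x \<longleftrightarrow> (\<exists>R A. x = R + k * (k - 1) * A \<and> k \<le> R \<and> R \<le> k * (k - 1))"
proof
  let ?M = "k * (k - 1)"
  assume ev: "evenoid k x"
  have M0: "0 < ?M" using assms by simp
  have dm: "x = x mod ?M + ?M * (x div ?M)" by simp
  show "\<exists>R A. x = R + ?M * A \<and> k \<le> R \<and> R \<le> ?M"
  proof (cases "x mod ?M = 0")
    case True
    then have "0 < x div ?M" using ev dm unfolding evenoid_def by (metis add_0 gr0I mult_0_right less_irrefl)
    then obtain a where "x div ?M = Suc a" using gr0_conv_Suc by blast
    then have "x = ?M + ?M * a" using dm True by simp
    moreover have "k \<le> ?M" using assms by simp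
    ultimately show ?thesis by blast
  next
    case False
    then have "k \<le> x mod ?M" using ev assms unfolding evenoid_def oddoid_def by auto
    moreover have "x mod ?M \<le> ?M" using M0 by (meson mod_less_divisor less_imp_le)
    ultimately show ?thesis using dm by blast
  qed
next
  let ?M = "k * (k - 1)"
  assume "\<exists>R A. x = R + ?M * A \<and> k \<le> R \<and> R \<le> ?M"
  then obtain R A where x: "x = R + ?M * A" and R: "k \<le> R" "R \<le> ?M" by blast
  have "x mod ?M = R mod ?M" unfolding x by (rule mod_mult_self2)
  also have "\<dots> = (if R = ?M then 0 else R)" using R by auto
  finally show "evenoid k x" using x R assms by (auto simp: evenoid_def oddoid_def)
qed

text \<open>The modulus divides \<open>k ^ e - k\<close>. Hence \<open>k ^ e\<close> has residue
  \<open>k\<close> (that is, 0 if \<open>k = 2\<close>) and begins a run of evenoids, just after a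
  run of oddoids ends.\<close>

lemma power_eq_add_mult:
  assumes "1 \<le> k" "1 \<le> e"
  shows "\<exists>q. (k::nat) ^ e = k + k * (k - 1) * q"
  using assms(2)
proof (induction e rule: dec_induct)
  case base
  show ?case by (intro exI[of _ 0]) simp
next
  case (step e)
  then obtain q where q: "k ^ e = k + k * (k - 1) * q" by blast
  obtain j where j: "k = Suc j" using assms(1) by (cases k) auto
  have "k ^ Suc e = k + k * (k - 1) * (1 + k * q)"
    using q j by (simp add: algebra_simps)
  then show ?case by blast
qed

lemma bounded_sum_exists:
  fixes S h n :: nat
  assumes "S \<le> n * h"
  shows "\<exists>f. (\<forall>i. f i \<le> h) \<and> (\<Sum>i<n. f i) = S"
  using assms
proof (induction n arbitrary: S)
  case 0
  then show ?case by (intro exI[of _ "\<lambda>_. 0"]) simp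
next
  case (Suc n)
  have "S - min S h \<le> n * h" using Suc.prems by auto
  then obtain f where f: "\<forall>i. f i \<le> h" "(\<Sum>i<n. f i) = S - min S h" using Suc.IH by blast
  have "(\<Sum>i<Suc n. (f(n := min S h)) i) = S" using f(2) by simp
  moreover have "\<forall>i. (f(n := min S h)) i \<le> h" using f(1) by simp
  ultimately show ?case by blast
qed

text \<open>Residue part \<open>R\<close> and quotient part \<open>A\<close> of \<open>x\<close> are
  distributed separately over the \<open>k\<close> parts. With
  \<open>k ^ e = k + k * (k - 1) * q\<close>, a part stays below \<open>k ^ e\<close> if its
  quotient is at most \<open>q\<close>, and \<open>k \<le> R\<close> together with
  \<open>x < k ^ Suc e\<close> leaves \<open>A \<le> k * q\<close> to distribute.\<close>

lemma evenoid_split_below_power: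
  assumes k: "2 \<le> k" and e: "1 \<le> e" and ev: "evenoid k x" and x: "x < k ^ Suc e"
  shows "\<exists>P. size P = k \<and> (\<forall>y\<in>#P. oddoid k y \<and> y < k ^ e) \<and> sum_mset P = x"
proof -
  let ?M = "k * (k - 1)"
  have M0: "0 < ?M" using k by simp
  obtain R A where xe: "x = R + ?M * A" and R: "k \<le> R" "R \<le> ?M"
    using ev evenoid_iff_decomposition[OF k] by blast
  obtain q where q: "k ^ e = k + ?M * q" using power_eq_add_mult[of k e] k e by auto
  obtain j where j: "k = Suc j" using k by (cases k) auto
  have "k ^ Suc e = k + ?M * (1 + k * q)" using q j by (simp add: algebra_simps)
  then have "?M * A < ?M * (1 + k * q)" using x xe R by linarith
  then have A: "A \<le> k * q" using M0 by (metis mult_less_cancel1 less_Suc_eq_le plus_1_eq_Suc)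
  \<comment> \<open>Each part gets residue 1 in advance, so \<open>R - k\<close> remains and each
    part can take up to \<open>k - 2\<close> more.\<close>
  have "R - k \<le> k * (k - 2)" using R(2) j by (simp add: algebra_simps)
  then obtain r where r: "\<forall>i. r i \<le> k - 2" "(\<Sum>i<k. r i) = R - k"
    using bounded_sum_exists by blast
  obtain a where a: "\<forall>i. a i \<le> q" "(\<Sum>i<k. a i) = A"
    using bounded_sum_exists[OF A] by blast
  define g where "g = (\<lambda>i. 1 + r i + ?M * a i)"
  have rM: "1 + r i \<le> k - 1" for i using r(1) k by (metis Suc_1 Suc_diff_le add_left_mono diff_Suc_Suc plus_1_eq_Suc)
  have "oddoid k (g i)" for i
  proof -
    have "k - 1 < ?M" using k by simp
    then have "1 + r i < ?M" using rM[of i] by linarith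
    then have "g i mod ?M = 1 + r i" unfolding g_def by (metis mod_less mod_mult_self2)
    then show ?thesis using rM[of i] unfolding oddoid_def g_def by simp
  qed
  moreover have "g i < k ^ e" for i
  proof -
    have "?M * a i \<le> ?M * q" using a(1) by simp
    then show ?thesis using rM[of i] k unfolding g_def q by linarith
  qed
  moreover have "(\<Sum>i<k. g i) = x"
    using r(2) a(2) R(1) unfolding g_def xe
    by (simp add: sum.distrib sum_distrib_left[symmetric] sum_Suc)
  ultimately show ?thesis
    by (intro exI[of _ "image_mset g (mset_set {..<k})"]) (auto simp: sum_unfold_sum_mset)
qed

text \<open>Each oddoid contributes a residue from 1 to \<open>k - 1\<close>. The induction tracks
  the sum of these without reducing it, over multisets of any size; at size \<open>k\<close> its
  range is the evenoid interval.\<close>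

lemma sum_oddoid_parts_evenoid:
  assumes k: "2 \<le> k" and P: "size P = k" "\<forall>y\<in>#P. oddoid k y"
  shows "evenoid k (sum_mset P)"
proof -
  let ?M = "k * (k - 1)"
  have "\<exists>R A. sum_mset P = R + ?M * A \<and> size P \<le> R \<and> R \<le> size P * (k - 1)"
    using P(2)
  proof (induction P)
    case empty
    show ?case by simp
  next
    case (add y P)
    then obtain R A where RA: "sum_mset P = R + ?M * A" "size P \<le> R" "R \<le> size P * (k - 1)"
      by auto
    have y: "1 \<le> y mod ?M" "y mod ?M \<le> k - 1"
      using add.prems by (auto simp: oddoid_def)
    have "sum_mset (add_mset y P) = (y mod ?M + R) + ?M * (y div ?M + A)"
      using RA(1) mod_mult_div_eq[of y ?M] by (simp add: distrib_left)
    moreover have "size (add_mset y P) \<le> y mod ?M + R" using RA(2) y(1) by simp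
    moreover have "y mod ?M + R \<le> size (add_mset y P) * (k - 1)" using RA(3) y(2) by simp
    ultimately show ?case by blast
  qed
  then show ?thesis using evenoid_iff_decomposition[OF k] P(1) by blast
qed

text \<open>The numbers from \<open>k ^ e\<close> to \<open>k ^ e + k - 2\<close> have
  \<open>R\<close> between \<open>k\<close> and \<open>2 * k - 2\<close>, hence are evenoid. The gap
  \<open>k - 1\<close> leaves room to split off \<open>k - 1\<close> single tokens and still keep
  \<open>k ^ e\<close>.\<close>

lemma oddoid_ge_power:
  assumes k: "2 \<le> k" and e: "1 \<le> e" and od: "oddoid k y" and y: "k ^ e \<le> y"
  shows "k ^ e + (k - 1) \<le> y"
proof (rule ccontr)
  assume "\<not> ?thesis"
  then obtain j where j: "y = k ^ e + j" "j < k - 1" using y by (metis le_Suc_ex nat_add_left_cancel_less not_le)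
  obtain q where q: "k ^ e = k + k * (k - 1) * q" using power_eq_add_mult[of k e] k e by auto
  have "2 * (k - 1) \<le> k * (k - 1)" using k by simp
  then have "k + j \<le> k * (k - 1)" using j(2) by linarith
  moreover have "y = (k + j) + k * (k - 1) * q" using j(1) q by simp
  ultimately have "evenoid k y" using evenoid_iff_decomposition[OF k] le_add1 by blast
  then show False using od by (simp add: evenoid_def)
qed

text \<open>If \<open>y\<close> exceeds \<open>k ^ e\<close> by at least \<open>k - 1\<close>, split
  off \<open>k - 1\<close> ones; the rest is large, so its type is unconstrained. Otherwise
  \<open>y\<close> is evenoid and below \<open>2 * k ^ e\<close>, so it splits into oddoids below
  \<open>k ^ e\<close>.\<close>

lemma split_at_most_one_large:
  assumes k: "2 \<le> k" and e: "1 \<le> e" and y: "k ^ e \<le> y"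
  shows "\<exists>P. size P = k \<and> (\<forall>v\<in>#P. 0 < v \<and> (v < k ^ e \<longrightarrow> oddoid k v)) \<and> sum_mset P = y \<and>
    size (filter_mset (\<lambda>v. k ^ e \<le> v) P) \<le> 1"
proof (cases "k ^ e + (k - 1) \<le> y")
  case True
  have "k ^ 1 \<le> k ^ e" using k e by (intro power_increasing) auto
  then have kp: "1 < k ^ e" "0 < y" using k y by auto
  have "k - 1 < k * (k - 1)" using k by simp
  then have "1 < k * (k - 1)" using k by linarith
  then have "oddoid k 1" using k by (simp add: oddoid_def)
  then show ?thesis using True kp k
    by (intro exI[of _ "add_mset (y - (k - 1)) (replicate_mset (k - 1) 1)"])
      (auto split: if_splits)
next
  case False
  have "2 * k ^ e \<le> k ^ Suc e" using k by simp
  moreover have "k \<le> k ^ e" using k e by (intro self_le_power) auto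
  ultimately have lt: "y < k ^ Suc e" using False k by linarith
  have "0 < k ^ e" using k by simp
  then have "0 < y" using y by linarith
  then have "evenoid k y"
    using oddoid_ge_power[OF k e _ y] False by (auto simp: evenoid_def)
  then obtain P where P: "size P = k" "\<forall>v\<in>#P. oddoid k v \<and> v < k ^ e" "sum_mset P = y"
    using evenoid_split_below_power[OF k e _ lt] by blast
  have "size (filter_mset (\<lambda>v. k ^ e \<le> v) P) = 0" using P(2) by (simp add: not_le)
  then have "size (filter_mset (\<lambda>v. k ^ e \<le> v) P) \<le> 1" by linarith
  moreover have "\<forall>v\<in>#P. 0 < v \<and> (v < k ^ e \<longrightarrow> oddoid k v)" using P(2) by (simp add: oddoid_def)
  ultimately show ?thesis using P(1,3) by blast
qed

section \<open>Moves by kept heaps, and counts of large heaps\<close>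

lemma nim_move_iff_kept:
  assumes "1 \<le> k"
  shows "nim_move k m Z Z' \<longleftrightarrow>
     (\<exists>K parts. K \<subseteq> {..<k * m} \<and> card K = m \<and>
        (\<forall>i \<in> K. size (parts i) = k \<and> (\<forall>x \<in># parts i. 0 < x) \<and> sum_mset (parts i) = Z ! i) \<and>
        mset Z' = (\<Sum>i \<in> K. parts i))" (is "_ \<longleftrightarrow> (\<exists>K parts. ?Q K parts)")
proof -
  have km: "k * m = (k - 1) * m + m" using assms by (cases k) auto
  have cc: "card ({..<k * m} - X) = k * m - card X" if "X \<subseteq> {..<k * m}" for X
    using that by (simp add: card_Diff_subset finite_subset)
  have dd: "{..<k * m} - ({..<k * m} - X) = X" if "X \<subseteq> {..<k * m}" for X
    using that by auto
  show ?thesis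
  proof
    assume "nim_move k m Z Z'"
    then obtain D parts where D: "D \<subseteq> {..<k * m}" "card D = (k - 1) * m"
      and p: "\<forall>i \<in> {..<k * m} - D. size (parts i) = k \<and> (\<forall>x \<in># parts i. 0 < x) \<and> sum_mset (parts i) = Z ! i"
        "mset Z' = (\<Sum>i \<in> {..<k * m} - D. parts i)"
      unfolding nim_move_def by metis
    have "?Q ({..<k * m} - D) parts" using cc[OF D(1)] D(2) km p by simp
    then show "\<exists>K parts. ?Q K parts" by blast
  next
    assume "\<exists>K parts. ?Q K parts"
    then obtain K parts where Q: "?Q K parts" by blast
    have "card ({..<k * m} - K) = (k - 1) * m" using cc[of K] Q km by simp
    then show "nim_move k m Z Z'"
      unfolding nim_move_def using Q dd[of K]
      by (intro exI[of _ "{..<k * m} - K"] exI[of _ parts]) auto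
  qed
qed

definition num_ge :: "nat \<Rightarrow> nat list \<Rightarrow> nat" where
  "num_ge c Z = size (filter_mset (\<lambda>x. c \<le> x) (mset Z))"

text \<open>Since \<open>num_ge\<close> is antitone in its threshold, the condition is strongest at
  the least admissible \<open>e\<close>; quantifying over all \<open>e\<close> avoids naming the
  integer logarithm of \<open>z\<close>.\<close>

definition balanced :: "nat \<Rightarrow> nat \<Rightarrow> nat list \<Rightarrow> bool" where
  "balanced k m Z \<longleftrightarrow> (\<forall>z\<in>set Z. \<forall>e. evenoid k z \<longrightarrow> z < k ^ Suc e \<longrightarrow> num_ge (k ^ e) Z < m)"

lemma num_ge_card: "num_ge c Z = card {i. i < length Z \<and> c \<le> Z ! i}"
  unfolding num_ge_def
  by (metis mset_filter size_mset length_filter_conv_card)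

lemma num_ge_antimono:
  assumes "c \<le> d"
  shows "num_ge d Z \<le> num_ge c Z"
  unfolding num_ge_card using assms by (intro card_mono) auto

lemma num_ge_sum_parts:
  assumes "mset Z' = (\<Sum>i\<in>K. parts i)" "finite K"
  shows "num_ge c Z' = (\<Sum>i\<in>K. size (filter_mset (\<lambda>x. c \<le> x) (parts i)))"
  unfolding num_ge_def assms(1) using assms(2)
  by (induction K rule: finite_induct) auto

section \<open>Moves between balanced and unbalanced positions\<close>

lemma unbalanced_move_balanced:
  assumes k: "2 \<le> k" and pos: "nim_position k m Z" and unb: "\<not> balanced k m Z"
  shows "\<exists>Z'. nim_move k m Z Z' \<and> balanced k m Z'"
proof -
  let ?B = "\<lambda>z e. z < k ^ Suc e \<and> m \<le> num_ge (k ^ e) Z"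
  have len: "length Z = k * m" using pos by (simp add: nim_position_def)
  obtain z e0 where z: "z \<in> set Z" "evenoid k z" and e0: "?B z e0"
    using unb unfolding balanced_def by (auto simp: not_less)
  \<comment> \<open>Minimality for this one \<open>z\<close> forces \<open>k ^ e \<le> z\<close>:
    otherwise \<open>e - 1\<close> would also offend, its lower threshold being met by at least as
    many heaps. So \<open>z\<close> itself counts among the large heaps.\<close>
  define e where "e = (LEAST e. ?B z e)"
  have e: "?B z e" unfolding e_def using e0 by (rule LeastI)
  have zk: "k \<le> z" using evenoid_iff_decomposition[OF k] z(2) by auto
  then have e1: "1 \<le> e" using e by (cases e) auto
  have ze: "k ^ e \<le> z"
  proof (rule ccontr)
    assume "\<not> ?thesis"
    moreover have "num_ge (k ^ e) Z \<le> num_ge (k ^ (e - 1)) Z"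
      using k by (intro num_ge_antimono power_increasing) auto
    ultimately have "?B z (e - 1)" using e e1 by simp
    then have "e \<le> e - 1" unfolding e_def by (rule Least_le)
    then show False using e1 by simp
  qed
  obtain j where j: "j < k * m" "Z ! j = z" using z(1) len by (metis in_set_conv_nth)
  let ?L = "{i. i < length Z \<and> k ^ e \<le> Z ! i}"
  have jL: "j \<in> ?L" using j len ze by simp
  have cL: "m \<le> card ?L" using e unfolding num_ge_card by simp
  have m0: "0 < m" using j by (cases m) auto
  have "m - 1 \<le> card (?L - {j})" using cL jL by simp
  then obtain K' where K': "K' \<subseteq> ?L - {j}" "card K' = m - 1" by (meson obtain_subset_with_card_n)
  define K where "K = insert j K'"
  have finK': "finite K'" using K'(1) finite_subset by fastforce
  have jK': "j \<notin> K'" using K' by auto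
  have K: "K \<subseteq> {..<k * m}" "card K = m" "finite K"
    using K' j len m0 finK' jK' unfolding K_def by auto
  obtain P where P: "size P = k" "\<forall>y\<in>#P. oddoid k y \<and> y < k ^ e" "sum_mset P = z"
    using evenoid_split_below_power[OF k e1 z(2)] e by blast
  have "\<forall>i\<in>K'. \<exists>P. size P = k \<and> (\<forall>v\<in>#P. 0 < v \<and> (v < k ^ e \<longrightarrow> oddoid k v)) \<and> sum_mset P = Z ! i \<and>
    size (filter_mset (\<lambda>v. k ^ e \<le> v) P) \<le> 1"
    using K'(1) split_at_most_one_large[OF k e1] by blast
  then obtain Q where Q: "\<forall>i\<in>K'. size (Q i) = k \<and> (\<forall>v\<in>#Q i. 0 < v \<and> (v < k ^ e \<longrightarrow> oddoid k v)) \<and>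
    sum_mset (Q i) = Z ! i \<and> size (filter_mset (\<lambda>v. k ^ e \<le> v) (Q i)) \<le> 1"
    by metis
  define parts where "parts = Q(j := P)"
  obtain Z' where Z': "mset Z' = (\<Sum>i\<in>K. parts i)" using ex_mset by blast
  have parts: "\<forall>i\<in>K. size (parts i) = k \<and> (\<forall>v\<in>#parts i. 0 < v \<and> (v < k ^ e \<longrightarrow> oddoid k v)) \<and>
    sum_mset (parts i) = Z ! i"
    using P Q j unfolding parts_def K_def by (auto simp: oddoid_def)
  have mv: "nim_move k m Z Z'"
    using nim_move_iff_kept[of k m Z Z'] k K Z' parts by (metis one_le_numeral order_trans)
  have Pe: "filter_mset (\<lambda>v. k ^ e \<le> v) P = {#}" using P(2) by (simp add: not_le)
  \<comment> \<open>Heap \<open>j\<close> leaves no large part and each of the other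
    \<open>m - 1\<close> kept heaps at most one.\<close>
  have "num_ge (k ^ e) Z' = (\<Sum>i\<in>K'. size (filter_mset (\<lambda>x. k ^ e \<le> x) (parts i)))"
    unfolding num_ge_sum_parts[OF Z' K(3)] unfolding K_def using finK' jK' Pe
    by (simp add: parts_def)
  also have "\<dots> \<le> (\<Sum>i\<in>K'. 1)"
    using Q jK' by (intro sum_mono) (auto simp: parts_def)
  finally have few: "num_ge (k ^ e) Z' < m" using K'(2) m0 by simp
  have "balanced k m Z'"
    unfolding balanced_def
  proof (intro ballI allI impI)
    fix w f assume w: "w \<in> set Z'" "evenoid k w" "w < k ^ Suc f"
    have "w \<in># (\<Sum>i\<in>K. parts i)" using w(1) Z' by (metis set_mset_mset)
    then obtain i where "i \<in> K" "w \<in># parts i" using K(3) by (auto simp: set_mset_sum)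
    \<comment> \<open>All evenoid parts are large, so only exponents \<open>f \<ge> e\<close> have
      to be checked, and the count at \<open>e\<close> bounds those.\<close>
    then have "k ^ e \<le> w" using parts w(2) by (meson evenoid_def not_less)
    then have "k ^ e < k ^ Suc f" using w(3) by linarith
    then have "e \<le> f" using k by (meson less_Suc_eq_le power_less_imp_less_exp one_less_numeral_iff less_le_trans semiring_norm(76))
    then have "num_ge (k ^ f) Z' \<le> num_ge (k ^ e) Z'"
      using k by (intro num_ge_antimono power_increasing) auto
    then show "num_ge (k ^ f) Z' < m" using few by simp
  qed
  then show ?thesis using mv by blast
qed

lemma balanced_move_unbalanced:
  assumes k: "2 \<le> k" and m: "1 \<le> m" and pos: "nim_position k m Z" and bal: "balanced k m Z"
    and mv: "nim_move k m Z Z'"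
  shows "\<not> balanced k m Z'"
proof -
  have len: "length Z = k * m" using pos by (simp add: nim_position_def)
  have "1 \<le> k" using k by simp
  then obtain K parts where K: "K \<subseteq> {..<k * m}" "card K = m"
    and parts: "\<forall>i\<in>K. size (parts i) = k \<and> (\<forall>x \<in># parts i. 0 < x) \<and> sum_mset (parts i) = Z ! i"
    and Z': "mset Z' = (\<Sum>i\<in>K. parts i)"
    using mv nim_move_iff_kept[of k m Z Z'] by metis
  have finK: "finite K" using K(1) finite_subset by blast
  have K0: "K \<noteq> {}" using K(2) m by auto
  have all_large: "m \<le> num_ge c Z" if "\<forall>i\<in>K. c \<le> Z ! i" for c
    using that K len unfolding num_ge_card K(2)[symmetric] by (intro card_mono) auto
  have part_in: "x \<in> set Z'" if "i \<in> K" "x \<in># parts i" for i x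
  proof -
    have "x \<in># (\<Sum>i\<in>K. parts i)" using that finK by (auto simp: set_mset_sum)
    then show ?thesis using Z' by (metis set_mset_mset)
  qed
  have pos': "\<And>x. x \<in> set Z' \<Longrightarrow> 0 < x"
    using nim_move_position[OF \<open>1 \<le> k\<close> mv] by (auto simp: nim_position_def)
  have small: "evenoid k (Z ! i)" if "i \<in> K" "\<forall>x\<in>#parts i. oddoid k x" for i
    using sum_oddoid_parts_evenoid[OF k, of "parts i"] parts that by metis
  define v where "v = Min ((!) Z ` K)"
  have "v \<in> (!) Z ` K" unfolding v_def using finK K0 by (intro Min_in) auto
  then obtain j where j: "j \<in> K" "Z ! j = v" by auto
  have vle: "\<forall>i\<in>K. v \<le> Z ! i" unfolding v_def using finK by simp
  have in_Z: "Z ! i \<in> set Z" if "i \<in> K" for i using that K(1) len by auto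
  \<comment> \<open>If the least kept heap \<open>v\<close> were evenoid with
    \<open>k ^ f \<le> v < k ^ Suc f\<close>, the \<open>m\<close> kept heaps would all reach
    \<open>k ^ f\<close>, against balance.\<close>
  have "\<not> evenoid k v"
  proof
    assume ev: "evenoid k v"
    then have "1 \<le> v" by (simp add: evenoid_def)
    then obtain f where f: "k ^ f \<le> v" "v < k ^ Suc f"
      using ex_power_ivl1[OF k, of v] by auto
    have "num_ge (k ^ f) Z < m" using bal ev f(2) j in_Z unfolding balanced_def by metis
    moreover have "m \<le> num_ge (k ^ f) Z" using all_large vle f(1) by (meson order_trans)
    ultimately show False by simp
  qed
  then obtain w where w: "w \<in># parts j" "\<not> oddoid k w" using small j by metis
  let ?S = "\<lambda>e. \<exists>x\<in>set Z'. evenoid k x \<and> x < k ^ Suc e"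
  have wZ': "w \<in> set Z'" using part_in[OF j(1) w(1)] .
  have wev: "evenoid k w" using w(2) pos'[OF wZ'] by (simp add: evenoid_def)
  have "w < k ^ w" using k by (intro power_gt_expt) auto
  then have "w < k ^ Suc w" using k by (meson lessI less_trans power_strict_increasing_iff less_le_trans one_less_numeral_iff semiring_norm(76))
  then have exS: "\<exists>e. ?S e" using wZ' wev by blast
  \<comment> \<open>This is the scale of the smallest evenoid heap in \<open>Z'\<close>: that heap
    is below \<open>k ^ Suc e\<close>, and all heaps below \<open>k ^ e\<close> are oddoid.\<close>
  define e where "e = (LEAST e. ?S e)"
  have Se: "?S e" unfolding e_def using exS by (rule LeastI_ex)
  have below: "oddoid k x" if "x \<in> set Z'" "x < k ^ e" for x
  proof (rule ccontr)
    assume "\<not> oddoid k x"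
    then have ev: "evenoid k x" using pos' that(1) by (simp add: evenoid_def)
    show False
    proof (cases e)
      case 0
      then show False using that pos' by force
    next
      case (Suc d)
      then have "?S d" using ev that by blast
      then have "e \<le> d" unfolding e_def by (rule Least_le)
      then show False using Suc by simp
    qed
  qed
  have "k ^ e \<le> w" using below wZ' w(2) by (meson not_less)
  \<comment> \<open>As \<open>w\<close> is a part of the least kept heap,
    \<open>k ^ e \<le> w\<close> passes to every kept heap.\<close>
  moreover have "w \<le> v"
    using w(1) parts j by (metis sum_mset.remove le_add1)
  ultimately have ve: "\<forall>i\<in>K. k ^ e \<le> Z ! i" using vle by fastforce
  have "\<exists>x\<in>#parts i. k ^ e \<le> x" if i: "i \<in> K" for i
  proof (rule ccontr)
    assume "\<not> ?thesis"
    then have lt: "\<forall>x\<in>#parts i. x < k ^ e" by (auto simp: not_le)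
    then have ev: "evenoid k (Z ! i)" using below part_in small i by blast
    have "sum_mset P < size P * c" if "\<forall>x\<in>#P. x < c" "P \<noteq> {#}" for P and c :: nat
      using that
    proof (induction P)
      case (add x P)
      then show ?case by (cases "P = {#}") auto
    qed simp
    moreover have "parts i \<noteq> {#}" using parts i k by fastforce
    ultimately have "Z ! i < k * k ^ e" using lt parts i by metis
    then have "num_ge (k ^ e) Z < m" using bal ev in_Z[OF i] unfolding balanced_def by simp
    then show False using all_large[OF ve] by simp
  qed
  then have "1 \<le> size (filter_mset (\<lambda>x. k ^ e \<le> x) (parts i))" if "i \<in> K" for i
    using that by (auto simp: Suc_le_eq nonempty_has_size[symmetric])
  then have "(\<Sum>i\<in>K. 1) \<le> num_ge (k ^ e) Z'"
    unfolding num_ge_sum_parts[OF Z' finK] by (intro sum_mono) auto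
  then have "m \<le> num_ge (k ^ e) Z'" using K(2) by simp
  then show ?thesis using Se unfolding balanced_def by (meson not_less)
qed

text \<open>Both properties obey the same recursion, true exactly when no move leads to a position
  with the property; induction on the number of tokens identifies them.\<close>

lemma P_position_iff_balanced:
  assumes k: "2 \<le> k" and m: "1 \<le> m" and "nim_position k m Z"
  shows "P_position k m Z \<longleftrightarrow> balanced k m Z"
  using assms(3)
proof (induction "sum_list Z" arbitrary: Z rule: less_induct)
  case less
  have "P_position k m Z' \<longleftrightarrow> balanced k m Z'" if "nim_move k m Z Z'" for Z'
    using less.hyps nim_move_less[OF k m less.prems that] nim_move_position[OF _ that] k by simp
  then show ?case
    using P_position_iff[OF k m less.prems] unbalanced_move_balanced[OF k less.prems]
      balanced_move_unbalanced[OF k m less.prems] by blast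
qed

section \<open>The criterion for sorted positions\<close>

text \<open>The 0-based indices from \<open>N\<close> on hold the \<open>m\<close> largest heaps,
  and \<open>Z ! N\<close> is the least of these. If it is below \<open>c\<close>, at most
  \<open>m - 1\<close> heaps reach \<open>c\<close>.\<close>

lemma num_ge_sorted:
  assumes "sorted Z" "length Z = N + m" "1 \<le> m"
  shows "m \<le> num_ge c Z \<longleftrightarrow> c \<le> Z ! N"
proof
  assume "c \<le> Z ! N"
  then have "{N..<N + m} \<subseteq> {i. i < length Z \<and> c \<le> Z ! i}"
    using assms by (auto intro: order_trans[OF _ sorted_nth_mono])
  then have "card {N..<N + m} \<le> num_ge c Z" unfolding num_ge_card by (intro card_mono) auto
  then show "m \<le> num_ge c Z" by simp
next
  assume le: "m \<le> num_ge c Z"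
  show "c \<le> Z ! N"
  proof (rule ccontr)
    assume n: "\<not> ?thesis"
    have "N < i" if "i < length Z" "c \<le> Z ! i" for i
      using n that assms sorted_nth_mono[OF assms(1), of i N] by (cases "N < i") auto
    then have "{i. i < length Z \<and> c \<le> Z ! i} \<subseteq> {Suc N..<N + m}"
      using assms(2) by (auto simp: Suc_le_eq)
    then have "num_ge c Z \<le> card {Suc N..<N + m}" unfolding num_ge_card by (intro card_mono) auto
    then show False using le assms(3) by simp
  qed
qed

theorem theorem5p6:
  fixes k m s :: nat and Z :: "nat list"
  assumes "2 \<le> k" and "1 \<le> m"
    and "nim_position k m Z"
    and "sorted Z"
    and "Z ! ((k - 1) * m) < k ^ s"
    and "\<forall>t. Z ! ((k - 1) * m) < k ^ t \<longrightarrow> k ^ s \<le> k ^ t"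
  shows "P_position k m Z \<longleftrightarrow>
    (\<forall>i \<in> {1..(k - 1) * m + 1}. oddoid k (Z ! (i - 1))) \<and>
    (\<forall>l \<in> {1..k * m}. evenoid k (Z ! (l - 1)) \<longrightarrow> k ^ s \<le> Z ! (l - 1))"
proof -
  let ?N = "(k - 1) * m"
  have k1: "1 < k" using assms(1) by simp
  have km: "k * m = ?N + m" using assms(1) by (cases k) auto
  have len: "length Z = ?N + m" using assms(3) km by (simp add: nim_position_def)
  have pos: "0 < z" if "z \<in> set Z" for z using assms(3) that by (simp add: nim_position_def)
  have few: "num_ge c Z < m \<longleftrightarrow> Z ! ?N < c" for c
    using num_ge_sorted[OF assms(4) len assms(2)] by (meson not_less)
  have "balanced k m Z \<longleftrightarrow> (\<forall>z\<in>set Z. evenoid k z \<longrightarrow> k ^ s \<le> z)"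
  proof
    assume bal: "balanced k m Z"
    show "\<forall>z\<in>set Z. evenoid k z \<longrightarrow> k ^ s \<le> z"
    proof (intro ballI impI, rule ccontr)
      fix z assume z: "z \<in> set Z" "evenoid k z" "\<not> k ^ s \<le> z"
      \<comment> \<open>Here \<open>s = 0\<close> would give \<open>z < 1\<close>. With
        \<open>s = Suc e\<close>, balance yields \<open>Z ! ?N < k ^ e\<close>, against the
        minimality of \<open>k ^ s\<close>.\<close>
      obtain e where s: "s = Suc e" using z(3) pos[OF z(1)] by (cases s) auto
      then have "Z ! ?N < k ^ e" using bal z few unfolding balanced_def by (simp add: not_le)
      then have "k ^ s \<le> k ^ e" using assms(6) by blast
      then show False using s k1 by simp
    qed
  next
    assume R: "\<forall>z\<in>set Z. evenoid k z \<longrightarrow> k ^ s \<le> z"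
    show "balanced k m Z"
      unfolding balanced_def few
    proof (intro ballI allI impI)
      fix z e assume z: "z \<in> set Z" "evenoid k z" "z < k ^ Suc e"
      have "k ^ s < k ^ Suc e" using R z by (meson le_less_trans)
      then have "s \<le> e" using k1 by (simp only: power_strict_increasing_iff less_Suc_eq_le)
      then have "k ^ s \<le> k ^ e" using k1 by simp
      then show "Z ! ?N < k ^ e" using assms(5) by simp
    qed
  qed
  also have "\<dots> \<longleftrightarrow> (\<forall>l \<in> {1..k * m}. evenoid k (Z ! (l - 1)) \<longrightarrow> k ^ s \<le> Z ! (l - 1))"
    (is "?A \<longleftrightarrow> ?B")
  proof
    assume ?A
    then show ?B using len km by auto
  next
    assume B: ?B
    show ?A
    proof
      fix z assume "z \<in> set Z"
      then obtain i where i: "i < k * m" "Z ! i = z" using len km by (metis in_set_conv_nth)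
      then show "evenoid k z \<longrightarrow> k ^ s \<le> z" using bspec[OF B, of "Suc i"] by simp
    qed
  qed
  also have "\<dots> \<longleftrightarrow> (\<forall>i \<in> {1..?N + 1}. oddoid k (Z ! (i - 1))) \<and> ?B"
  proof -
    \<comment> \<open>By sortedness the first \<open>?N + 1\<close> heaps are at most
      \<open>Z ! ?N < k ^ s\<close>, so an evenoid among them would violate
      \<open>?B\<close>.\<close>
    have "oddoid k (Z ! (i - 1))" if B: ?B and i: "i \<in> {1..?N + 1}" for i
    proof (rule ccontr)
      assume "\<not> ?thesis"
      moreover have "i - 1 < length Z" using i len assms(2) by auto
      ultimately have "evenoid k (Z ! (i - 1))" using pos by (simp add: evenoid_def)
      moreover have "i \<in> {1..k * m}" using i km assms(2) by auto
      ultimately have "k ^ s \<le> Z ! (i - 1)" using B by blast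
      moreover have "Z ! (i - 1) \<le> Z ! ?N" using i len assms(2,4) by (intro sorted_nth_mono) auto
      ultimately show False using assms(5) by simp
    qed
    then show ?thesis by blast
  qed
  finally show ?thesis using P_position_iff_balanced[OF assms(1-3)] by simp
qed

end
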